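(* Let $E(H,K)\equiv e\to H\xrightarrow{i} G\xrightarrow{\beta} K\to e$ be a center extension of multiplicative Lie algebras, let $t:K\to G$ be a transversal, and let $f,h:K\times K\to H$ and $\Gamma_x\in \mathrm{End}(H)$ ($x\in K$) be the associated maps. Then a pair $(\alpha,\eta)\in \mathrm{Aut}(H)\times \mathrm{Aut}(K)$ is inducible if and only if there exists a map $\lambda:K\to H$ such that the following conditions hold for all $x,y\in K$ and $a\in H$: (1) $f(\eta(x),\eta(y))\,\alpha(f(x,y))^{-1}=\lambda(xy)\lambda(x)^{-1}\lambda(y)^{-1}$; (2) $h(\eta(x),\eta(y))\,\alpha(h(x,y))^{-1}=\lambda(x\star y)\,\Gamma_{\eta(y)}(\lambda(x))\,\Gamma_{\eta(x)}(\lambda(y)^{-1})$; (3) $\Gamma_{\eta(x)}=\alpha\Gamma_x\alpha^{-1}$, equivalently $\alpha(t(x)\star a)=t(\eta(x))\star\alpha(a)$.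
   Context: A multiplicative Lie algebra is a triple $(G,\cdot,\star)$ where $(G,\cdot)$ is a (possibly non-abelian) group with identity $e$ and $\star$ is a binary operation such that for all $x,y,z\in G$, writing ${}^zx=zxz^{-1}$: $x\star x=e$; $x\star(yz)=(x\star y)\cdot{}^y(x\star z)$; $(xy)\star z={}^x(y\star z)\cdot(x\star z)$; $((x\star y)\star{}^yz)((y\star z)\star{}^zx)((z\star x)\star{}^xy)=e$; ${}^z(x\star y)={}^zx\star{}^zy$. Homomorphisms preserve both operations, and $\mathrm{Aut}$ denotes the group of automorphisms of a multiplicative Lie algebra. A center extension $E(H,K)\equiv e\to H\xrightarrow{i} G\xrightarrow{\beta}K\to e$ is a short exact sequence of multiplicative Lie algebras in which $H$ (identified with $i(H)=\ker\beta$) is contained in the group center $Z(G)$ and $a\star b=e$ for all $a,b\in H$. $H$ is an ideal of $G$, so $g\star a\in H$ for $g\in G$, $a\in H$. A transversal is a map $t:K\to G$ with $\beta(t(x))=x$ for all $x\in K$ and $t(e)=e$. The associated maps are $f(x,y)=t(x)t(y)t(xy)^{-1}$, $h(x,y)=(t(x)\star t(y))\,t(x\star y)^{-1}$ and $\Gamma_x(a)=t(x)\star a$, for $x,y\in K$, $a\in H$; $f,h$ take values in $H$ and $\Gamma_x$ is an endomorphism of $H$. Let $\mathrm{Aut}_H(G)=\{\phi\in\mathrm{Aut}(G):\phi(H)=H\}$. Define $\Pi:\mathrm{Aut}_H(G)\to\mathrm{Aut}(H)\times\mathrm{Aut}(K)$, $\Pi(\phi)=(\alpha,\eta)$, by $\alpha=\phi|_H$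 and $\eta(x)=\beta(\phi(t(x)))$. A pair $(\alpha,\eta)$ is inducible if $(\alpha,\eta)=\Pi(\phi)$ for some $\phi\in\mathrm{Aut}_H(G)$. *)

theory Defs
  imports "HOL-Algebra.Algebra"
begin

record 'a mult_lie = "'a monoid" +
  star :: "'a \<Rightarrow> 'a \<Rightarrow> 'a" (infixl \<open>\<star>\<index>\<close> 70)

definition conjugate :: "('a, 'm) monoid_scheme \<Rightarrow> 'a \<Rightarrow> 'a \<Rightarrow> 'a"
  where "conjugate G z x = z \<otimes>\<^bsub>G\<^esub> x \<otimes>\<^bsub>G\<^esub> inv\<^bsub>G\<^esub> z"

definition group_center :: "('a, 'm) monoid_scheme \<Rightarrow> 'a set"
  where "group_center G = {z \<in> carrier G. \<forall>g\<in>carrier G. z \<otimes>\<^bsub>G\<^esub> g = g \<otimes>\<^bsub>G\<^esub> z}"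

locale multiplicative_lie_algebra =
  group G for G :: "('a, 'm) mult_lie_scheme" (structure) +
  assumes star_closed:
      "\<lbrakk>x \<in> carrier G; y \<in> carrier G\<rbrakk> \<Longrightarrow> x \<star> y \<in> carrier G"
    and star_self:
      "x \<in> carrier G \<Longrightarrow> x \<star> x = \<one>"
    and star_mult_right:
      "\<lbrakk>x \<in> carrier G; y \<in> carrier G; z \<in> carrier G\<rbrakk>
        \<Longrightarrow> x \<star> (y \<otimes> z) = (x \<star> y) \<otimes> conjugate G y (x \<star> z)"
    and star_mult_left:
      "\<lbrakk>x \<in> carrier G; y \<in> carrier G; z \<in> carrier G\<rbrakk>
        \<Longrightarrow> (x \<otimes> y) \<star> z = conjugate G x (y \<star> z) \<otimes> (x \<star> z)"
    and star_jacobi: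
      "\<lbrakk>x \<in> carrier G; y \<in> carrier G; z \<in> carrier G\<rbrakk>
        \<Longrightarrow> ((x \<star> y) \<star> conjugate G y z) \<otimes> ((y \<star> z) \<star> conjugate G z x)
              \<otimes> ((z \<star> x) \<star> conjugate G x y) = \<one>"
    and conjugate_star:
      "\<lbrakk>x \<in> carrier G; y \<in> carrier G; z \<in> carrier G\<rbrakk>
        \<Longrightarrow> conjugate G z (x \<star> y) = conjugate G z x \<star> conjugate G z y"

definition mla_hom :: "('a, 'm) mult_lie_scheme \<Rightarrow> ('b, 'n) mult_lie_scheme \<Rightarrow> ('a \<Rightarrow> 'b) set"
  where "mla_hom G K =
    {\<phi> \<in> hom G K. \<forall>x\<in>carrier G. \<forall>y\<in>carrier G. \<phi> (x \<star>\<^bsub>G\<^esub> y) = \<phi> x \<star>\<^bsub>K\<^esub> \<phi> y}"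

text \<open>As with \<^const>\<open>auto\<close>, automorphisms are extensional functions on the carrier,
  so equality of automorphisms is equality of functions.\<close>

definition mla_auto :: "('a, 'm) mult_lie_scheme \<Rightarrow> ('a \<Rightarrow> 'a) set"
  where "mla_auto G = mla_hom G G \<inter> auto G"

locale center_extension =
  H: multiplicative_lie_algebra H + G: multiplicative_lie_algebra G +
  K: multiplicative_lie_algebra K
  for H :: "('h, 'l) mult_lie_scheme"
    and i :: "'h \<Rightarrow> 'g"
    and G :: "('g, 'm) mult_lie_scheme"
    and \<beta> :: "'g \<Rightarrow> 'k"
    and K :: "('k, 'n) mult_lie_scheme" +
  assumes i_hom: "i \<in> mla_hom H G"
    and \<beta>_hom: "\<beta> \<in> mla_hom G K"
    and i_inj: "inj_on i (carrier H)"
    and exact: "i ` carrier H = kernel G K \<beta>"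
    and \<beta>_surj: "\<beta> ` carrier G = carrier K"
    and central: "i ` carrier H \<subseteq> group_center G"
    and star_trivial: "\<lbrakk>a \<in> carrier H; b \<in> carrier H\<rbrakk> \<Longrightarrow> a \<star>\<^bsub>H\<^esub> b = \<one>\<^bsub>H\<^esub>"

definition transversal ::
    "('g, 'm) mult_lie_scheme \<Rightarrow> ('g \<Rightarrow> 'k) \<Rightarrow> ('k, 'n) mult_lie_scheme \<Rightarrow> ('k \<Rightarrow> 'g) \<Rightarrow> bool"
  where "transversal G \<beta> K t \<longleftrightarrow>
    t \<in> carrier K \<rightarrow> carrier G \<and> (\<forall>x\<in>carrier K. \<beta> (t x) = x) \<and> t \<one>\<^bsub>K\<^esub> = \<one>\<^bsub>G\<^esub>"

text \<open>The identification of \<open>i(H)\<close> with \<open>H\<close> is made explicit: \<open>pullback H i z\<close> is the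
  element of \<open>H\<close> that \<open>i\<close> sends to \<open>z\<close>. It is meaningful only for \<open>z\<close> in the image of \<open>i\<close>;
  in a center extension with a transversal, all arguments below lie there.\<close>

definition pullback :: "('h, 'l) mult_lie_scheme \<Rightarrow> ('h \<Rightarrow> 'g) \<Rightarrow> 'g \<Rightarrow> 'h"
  where "pullback H i z = inv_into (carrier H) i z"

definition assoc_f ::
    "('h, 'l) mult_lie_scheme \<Rightarrow> ('h \<Rightarrow> 'g) \<Rightarrow> ('g, 'm) mult_lie_scheme
      \<Rightarrow> ('k, 'n) mult_lie_scheme \<Rightarrow> ('k \<Rightarrow> 'g) \<Rightarrow> 'k \<Rightarrow> 'k \<Rightarrow> 'h"
  where "assoc_f H i G K t x y =
    pullback H i (t x \<otimes>\<^bsub>G\<^esub> t y \<otimes>\<^bsub>G\<^esub> inv\<^bsub>G\<^esub> t (x \<otimes>\<^bsub>K\<^esub> y))"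

definition assoc_h ::
    "('h, 'l) mult_lie_scheme \<Rightarrow> ('h \<Rightarrow> 'g) \<Rightarrow> ('g, 'm) mult_lie_scheme
      \<Rightarrow> ('k, 'n) mult_lie_scheme \<Rightarrow> ('k \<Rightarrow> 'g) \<Rightarrow> 'k \<Rightarrow> 'k \<Rightarrow> 'h"
  where "assoc_h H i G K t x y =
    pullback H i ((t x \<star>\<^bsub>G\<^esub> t y) \<otimes>\<^bsub>G\<^esub> inv\<^bsub>G\<^esub> t (x \<star>\<^bsub>K\<^esub> y))"

definition assoc_\<Gamma> ::
    "('h, 'l) mult_lie_scheme \<Rightarrow> ('h \<Rightarrow> 'g) \<Rightarrow> ('g, 'm) mult_lie_scheme
      \<Rightarrow> ('k \<Rightarrow> 'g) \<Rightarrow> 'k \<Rightarrow> 'h \<Rightarrow> 'h"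
  where "assoc_\<Gamma> H i G t x a = pullback H i (t x \<star>\<^bsub>G\<^esub> i a)"

definition Aut_sub ::
    "('h, 'l) mult_lie_scheme \<Rightarrow> ('h \<Rightarrow> 'g) \<Rightarrow> ('g, 'm) mult_lie_scheme \<Rightarrow> ('g \<Rightarrow> 'g) set"
  where "Aut_sub H i G = {\<phi> \<in> mla_auto G. \<phi> ` i ` carrier H = i ` carrier H}"

definition induced_pair ::
    "('h, 'l) mult_lie_scheme \<Rightarrow> ('h \<Rightarrow> 'g) \<Rightarrow> ('g \<Rightarrow> 'k) \<Rightarrow> ('k, 'n) mult_lie_scheme
      \<Rightarrow> ('k \<Rightarrow> 'g) \<Rightarrow> ('g \<Rightarrow> 'g) \<Rightarrow> ('h \<Rightarrow> 'h) \<times> ('k \<Rightarrow> 'k)"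
  where "induced_pair H i \<beta> K t \<phi> =
    ((\<lambda>a\<in>carrier H. pullback H i (\<phi> (i a))), (\<lambda>x\<in>carrier K. \<beta> (\<phi> (t x))))"

definition inducible ::
    "('h, 'l) mult_lie_scheme \<Rightarrow> ('h \<Rightarrow> 'g) \<Rightarrow> ('g, 'm) mult_lie_scheme \<Rightarrow> ('g \<Rightarrow> 'k)
      \<Rightarrow> ('k, 'n) mult_lie_scheme \<Rightarrow> ('k \<Rightarrow> 'g) \<Rightarrow> ('h \<Rightarrow> 'h) \<times> ('k \<Rightarrow> 'k) \<Rightarrow> bool"
  where "inducible H i G \<beta> K t p \<longleftrightarrow> (\<exists>\<phi>\<in>Aut_sub H i G. p = induced_pair H i \<beta> K t \<phi>)"

end

theory Submission
  imports Defs
begin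

text \<open>
  Identify \<open>H\<close> with its image in \<open>G\<close>. Every element of \<open>G\<close> is uniquely a product \<open>a \<cdot> t(x)\<close> with
  \<open>a \<in> H\<close> and \<open>x \<in> K\<close>, and both operations of \<open>G\<close> can be computed in these coordinates from
  the three structure equations
  \<open>t(x) t(y) = f(x,y) t(xy)\<close>, \<open>t(x) \<star> t(y) = h(x,y) t(x \<star> y)\<close>, \<open>t(x) \<star> a = \<Gamma>\<^sub>x(a)\<close>,
  because \<open>H\<close> is central and \<open>\<star>\<close> vanishes on \<open>H\<close> (lemmas \<open>mult_coordinates\<close> and
  \<open>star_coordinates\<close>). An automorphism \<open>\<phi>\<close> inducing \<open>(\<alpha>, \<eta>)\<close> is therefore determined by \<open>\<alpha>\<close>
  and the family \<open>T(x) = \<phi>(t(x))\<close>, which lies over \<open>\<eta>\<close> and must satisfy the structure equations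
  with all coefficients transported by \<open>\<alpha>\<close>. Conversely, for any such family the formula
  \<open>a \<cdot> t(x) \<mapsto> \<alpha>(a) \<cdot> T(x)\<close> defines an automorphism. This is lemma \<open>inducible_iff_family\<close>.

  A family over \<open>\<eta>\<close> is the same thing as a map \<open>\<lambda> : K \<rightarrow> H\<close>, through \<open>T(x) = \<lambda>(x) t(\<eta>(x))\<close>.
  Expanding the transported structure equations for this \<open>T\<close> and cancelling \<open>t\<close> leaves the
  three conditions of the theorem (lemma \<open>transported_equations_iff\<close>). The signs in the second one come from the
  antisymmetry \<open>x \<star> y = (y \<star> x)\<^sup>-\<^sup>1\<close>.
\<close>

section \<open>Multiplicative Lie algebras\<close>

context multiplicative_lie_algebra
begin

lemma star_one_right:
  assumes "x \<in> carrier G" shows "x \<star> \<one> = \<one>"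
proof -
  have "x \<star> \<one> = (x \<star> \<one>) \<otimes> (x \<star> \<one>)"
    using star_mult_right[of x \<one> \<one>] assms by (simp add: conjugate_def star_closed)
  then show ?thesis
    using assms by (simp add: star_closed)
qed

text \<open>As for commutators, antisymmetry follows by expanding \<open>(xy) \<star> (xy) = \<one>\<close>, which leaves a
  conjugate of \<open>(y \<star> x) (x \<star> y)\<close>.\<close>

lemma star_antisym:
  assumes x: "x \<in> carrier G" and y: "y \<in> carrier G"
  shows "x \<star> y = inv (y \<star> x)"
proof -
  note [simp] = star_closed
  have "\<one> = (x \<otimes> y) \<star> (x \<otimes> y)"
    using x y by (simp add: star_self)
  also have "\<dots> = conjugate G x (y \<star> (x \<otimes> y)) \<otimes> (x \<star> (x \<otimes> y))"
    using x y by (simp add: star_mult_left)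
  also have "y \<star> (x \<otimes> y) = y \<star> x"
    using x y by (simp add: star_mult_right star_self conjugate_def)
  also have "x \<star> (x \<otimes> y) = conjugate G x (x \<star> y)"
    using x y by (simp add: star_mult_right star_self conjugate_def)
  also have "conjugate G x (y \<star> x) \<otimes> conjugate G x (x \<star> y)
      = conjugate G x ((y \<star> x) \<otimes> (x \<star> y))"
    using x y by (simp add: conjugate_def m_assoc inv_solve_left')
  finally have "x \<otimes> ((y \<star> x) \<otimes> (x \<star> y)) \<otimes> inv x = \<one>"
    by (simp add: conjugate_def)
  then have "x \<otimes> ((y \<star> x) \<otimes> (x \<star> y)) = x"
    using x y by (metis inv_closed inv_equality inv_inv m_closed star_closed)
  then have "(y \<star> x) \<otimes> (x \<star> y) = \<one>"
    using x y by (metis l_cancel_one' m_closed star_closed)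
  then show ?thesis
    using x y by (metis inv_equality inv_inv inv_closed star_closed)
qed

end

lemma mla_homD:
  assumes "\<phi> \<in> mla_hom G K"
  shows "\<And>x. x \<in> carrier G \<Longrightarrow> \<phi> x \<in> carrier K"
    and "\<And>x y. \<lbrakk>x \<in> carrier G; y \<in> carrier G\<rbrakk> \<Longrightarrow> \<phi> (x \<otimes>\<^bsub>G\<^esub> y) = \<phi> x \<otimes>\<^bsub>K\<^esub> \<phi> y"
    and "\<And>x y. \<lbrakk>x \<in> carrier G; y \<in> carrier G\<rbrakk> \<Longrightarrow> \<phi> (x \<star>\<^bsub>G\<^esub> y) = \<phi> x \<star>\<^bsub>K\<^esub> \<phi> y"
  using assms by (auto simp: mla_hom_def hom_def)

lemma mla_autoD:
  assumes "\<phi> \<in> mla_auto G"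
  shows "\<phi> \<in> mla_hom G G" and "\<phi> \<in> extensional (carrier G)"
    and "bij_betw \<phi> (carrier G) (carrier G)"
  using assms by (auto simp: mla_auto_def auto_def Bij_def)

section \<open>Coordinates in a center extension\<close>

context center_extension
begin

lemmas i_closed [simp, intro] = mla_homD(1)[OF i_hom]
  and i_mult = mla_homD(2)[OF i_hom]
  and \<beta>_closed [simp, intro] = mla_homD(1)[OF \<beta>_hom]
  and \<beta>_mult [simp] = mla_homD(2)[OF \<beta>_hom]
  and \<beta>_star [simp] = mla_homD(3)[OF \<beta>_hom]
  and [simp] = H.star_closed G.star_closed K.star_closed

lemma group_hom_i: "group_hom H G i"
  using i_hom by (simp add: group_hom_def group_hom_axioms_def mla_hom_def)

lemma group_hom_\<beta>: "group_hom G K \<beta>"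
  using \<beta>_hom by (simp add: group_hom_def group_hom_axioms_def mla_hom_def)

lemmas i_one [simp] = group_hom.hom_one[OF group_hom_i]
  and i_inv = group_hom.hom_inv[OF group_hom_i]
  and \<beta>_one [simp] = group_hom.hom_one[OF group_hom_\<beta>]
  and \<beta>_inv [simp] = group_hom.hom_inv[OF group_hom_\<beta>]

lemma i_eq_iff [simp]:
  "\<lbrakk>a \<in> carrier H; b \<in> carrier H\<rbrakk> \<Longrightarrow> i a = i b \<longleftrightarrow> a = b"
  using i_inj by (auto dest: inj_onD)

lemma \<beta>_i [simp]: "a \<in> carrier H \<Longrightarrow> \<beta> (i a) = \<one>\<^bsub>K\<^esub>"
  using exact by (auto simp: kernel_def)

lemma i_star_i: "\<lbrakk>a \<in> carrier H; b \<in> carrier H\<rbrakk> \<Longrightarrow> i a \<star>\<^bsub>G\<^esub> i b = \<one>\<^bsub>G\<^esub>"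
  by (metis i_hom mla_homD(3) star_trivial i_one)

lemma i_commute:
  "\<lbrakk>a \<in> carrier H; g \<in> carrier G\<rbrakk> \<Longrightarrow> g \<otimes>\<^bsub>G\<^esub> i a = i a \<otimes>\<^bsub>G\<^esub> g"
  using central by (force simp: group_center_def)

lemma comm_group_H: "comm_group H"
proof (rule H.group_comm_groupI)
  fix a b assume ab: "a \<in> carrier H" "b \<in> carrier H"
  then have "i (a \<otimes>\<^bsub>H\<^esub> b) = i (b \<otimes>\<^bsub>H\<^esub> a)"
    using i_commute[of b "i a"] by (simp add: i_mult)
  with ab show "a \<otimes>\<^bsub>H\<^esub> b = b \<otimes>\<^bsub>H\<^esub> a"
    by simp
qed

lemma kernel_pullback:
  assumes "g \<in> carrier G" "\<beta> g = \<one>\<^bsub>K\<^esub>"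
  shows "pullback H i g \<in> carrier H" "i (pullback H i g) = g"
proof -
  have "g \<in> i ` carrier H"
    using assms exact by (simp add: kernel_def)
  then show "pullback H i g \<in> carrier H" "i (pullback H i g) = g"
    by (simp_all add: pullback_def inv_into_into f_inv_into_f)
qed

lemma pullback_i [simp]: "a \<in> carrier H \<Longrightarrow> pullback H i (i a) = a"
  using i_inj by (simp add: pullback_def)

lemma conjugate_i:
  "\<lbrakk>a \<in> carrier H; g \<in> carrier G\<rbrakk> \<Longrightarrow> conjugate G (i a) g = g"
  by (simp add: conjugate_def i_commute[symmetric] G.m_assoc)

lemma conjugate_of_i:
  "\<lbrakk>a \<in> carrier H; g \<in> carrier G\<rbrakk> \<Longrightarrow> conjugate G g (i a) = i a"
  by (simp add: conjugate_def i_commute G.m_assoc)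

definition action :: "'g \<Rightarrow> 'h \<Rightarrow> 'h"
  where "action g a = pullback H i (g \<star>\<^bsub>G\<^esub> i a)"

lemma action:
  assumes "g \<in> carrier G" "a \<in> carrier H"
  shows action_closed: "action g a \<in> carrier H"
    and i_action: "i (action g a) = g \<star>\<^bsub>G\<^esub> i a"
  unfolding action_def
  using assms by (auto intro!: kernel_pullback simp: K.star_one_right)

lemma action_inv:
  assumes "g \<in> carrier G" "a \<in> carrier H"
  shows "action g (inv\<^bsub>H\<^esub> a) = inv\<^bsub>H\<^esub> action g a"
proof -
  have mult: "action g (b \<otimes>\<^bsub>H\<^esub> c) = action g b \<otimes>\<^bsub>H\<^esub> action g c"
    if "b \<in> carrier H" "c \<in> carrier H" for b c
  proof -
    have "i (action g (b \<otimes>\<^bsub>H\<^esub> c)) = i (action g b) \<otimes>\<^bsub>G\<^esub> conjugate G (i b) (i (action g c))"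
      using that assms by (simp add: i_action i_mult G.star_mult_right)
    also have "conjugate G (i b) (i (action g c)) = i (action g c)"
      using that assms by (simp add: conjugate_of_i action_closed)
    finally have "i (action g (b \<otimes>\<^bsub>H\<^esub> c)) = i (action g b \<otimes>\<^bsub>H\<^esub> action g c)"
      using that assms by (simp add: i_mult action_closed)
    then show ?thesis
      using that assms by (simp add: action_closed)
  qed
  interpret A: group_hom H H "action g"
    by unfold_locales (use assms mult in \<open>auto simp: hom_def action_closed\<close>)
  show ?thesis
    using assms by simp
qed

lemma mult_central_factors:
  assumes "a \<in> carrier H" "b \<in> carrier H" "g \<in> carrier G" "g' \<in> carrier G"
  shows "(i a \<otimes>\<^bsub>G\<^esub> g) \<otimes>\<^bsub>G\<^esub> (i b \<otimes>\<^bsub>G\<^esub> g') = i (a \<otimes>\<^bsub>H\<^esub> b) \<otimes>\<^bsub>G\<^esub> (g \<otimes>\<^bsub>G\<^esub> g')"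
proof -
  have "(i a \<otimes>\<^bsub>G\<^esub> g) \<otimes>\<^bsub>G\<^esub> (i b \<otimes>\<^bsub>G\<^esub> g') = i a \<otimes>\<^bsub>G\<^esub> (g \<otimes>\<^bsub>G\<^esub> i b) \<otimes>\<^bsub>G\<^esub> g'"
    using assms by (simp add: G.m_assoc)
  also have "g \<otimes>\<^bsub>G\<^esub> i b = i b \<otimes>\<^bsub>G\<^esub> g"
    using assms by (simp add: i_commute)
  finally show ?thesis
    using assms by (simp add: G.m_assoc i_mult)
qed

text \<open>Central factors contribute to \<open>\<star>\<close> only through the action on \<open>H\<close>; the factor
  \<open>i a \<star> i b\<close> of the bilinear expansion vanishes.\<close>

lemma star_central_factors:
  assumes a: "a \<in> carrier H" and b: "b \<in> carrier H"
    and g: "g \<in> carrier G" and g': "g' \<in> carrier G"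
  shows "(i a \<otimes>\<^bsub>G\<^esub> g) \<star>\<^bsub>G\<^esub> (i b \<otimes>\<^bsub>G\<^esub> g')
    = i (action g b \<otimes>\<^bsub>H\<^esub> inv\<^bsub>H\<^esub> action g' a) \<otimes>\<^bsub>G\<^esub> (g \<star>\<^bsub>G\<^esub> g')"
proof -
  note cl = a b g g' action_closed
  have right: "k \<star>\<^bsub>G\<^esub> (i b \<otimes>\<^bsub>G\<^esub> g') = (k \<star>\<^bsub>G\<^esub> i b) \<otimes>\<^bsub>G\<^esub> (k \<star>\<^bsub>G\<^esub> g')" if "k \<in> carrier G" for k
    using that cl by (simp add: G.star_mult_right conjugate_i)
  have "i a \<star>\<^bsub>G\<^esub> g' = i (inv\<^bsub>H\<^esub> action g' a)"
    using cl G.star_antisym[of "i a" g'] by (simp add: i_action i_inv)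
  then have left: "i a \<star>\<^bsub>G\<^esub> (i b \<otimes>\<^bsub>G\<^esub> g') = i (inv\<^bsub>H\<^esub> action g' a)"
    using cl by (simp add: right i_star_i)
  have "(i a \<otimes>\<^bsub>G\<^esub> g) \<star>\<^bsub>G\<^esub> (i b \<otimes>\<^bsub>G\<^esub> g')
      = (g \<star>\<^bsub>G\<^esub> (i b \<otimes>\<^bsub>G\<^esub> g')) \<otimes>\<^bsub>G\<^esub> (i a \<star>\<^bsub>G\<^esub> (i b \<otimes>\<^bsub>G\<^esub> g'))"
    using cl by (simp add: G.star_mult_left conjugate_i)
  also have "\<dots> = (i (action g b) \<otimes>\<^bsub>G\<^esub> (g \<star>\<^bsub>G\<^esub> g')) \<otimes>\<^bsub>G\<^esub> (i (inv\<^bsub>H\<^esub> action g' a) \<otimes>\<^bsub>G\<^esub> \<one>\<^bsub>G\<^esub>)"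
    using cl by (simp add: right left i_action)
  also have "\<dots> = i (action g b \<otimes>\<^bsub>H\<^esub> inv\<^bsub>H\<^esub> action g' a) \<otimes>\<^bsub>G\<^esub> (g \<star>\<^bsub>G\<^esub> g')"
    using cl by (subst mult_central_factors) simp_all
  finally show ?thesis .
qed

end

locale center_extension_with_transversal =
  center_extension H i G \<beta> K
  for H :: "('h, 'l) mult_lie_scheme"
    and i :: "'h \<Rightarrow> 'g"
    and G :: "('g, 'm) mult_lie_scheme"
    and \<beta> :: "'g \<Rightarrow> 'k"
    and K :: "('k, 'n) mult_lie_scheme" +
  fixes t :: "'k \<Rightarrow> 'g"
  assumes transversal_t: "transversal G \<beta> K t"
begin

abbreviation "f \<equiv> assoc_f H i G K t"
abbreviation "h \<equiv> assoc_h H i G K t"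
abbreviation "\<Gamma> \<equiv> assoc_\<Gamma> H i G t"

lemma t_closed [simp, intro]: "x \<in> carrier K \<Longrightarrow> t x \<in> carrier G"
  and \<beta>_t [simp]: "x \<in> carrier K \<Longrightarrow> \<beta> (t x) = x"
  and t_one [simp]: "t \<one>\<^bsub>K\<^esub> = \<one>\<^bsub>G\<^esub>"
  using transversal_t by (auto simp: transversal_def)

lemma f_mult:
  assumes "x \<in> carrier K" "y \<in> carrier K"
  shows f_closed: "f x y \<in> carrier H"
    and t_mult: "t x \<otimes>\<^bsub>G\<^esub> t y = i (f x y) \<otimes>\<^bsub>G\<^esub> t (x \<otimes>\<^bsub>K\<^esub> y)"
proof -
  let ?g = "t x \<otimes>\<^bsub>G\<^esub> t y \<otimes>\<^bsub>G\<^esub> inv\<^bsub>G\<^esub> t (x \<otimes>\<^bsub>K\<^esub> y)"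
  have "?g \<in> carrier G" "\<beta> ?g = \<one>\<^bsub>K\<^esub>"
    using assms by simp_all
  then show "f x y \<in> carrier H" "t x \<otimes>\<^bsub>G\<^esub> t y = i (f x y) \<otimes>\<^bsub>G\<^esub> t (x \<otimes>\<^bsub>K\<^esub> y)"
    using assms by (simp_all add: assoc_f_def kernel_pullback G.m_assoc)
qed

lemma h_star:
  assumes "x \<in> carrier K" "y \<in> carrier K"
  shows h_closed: "h x y \<in> carrier H"
    and t_star: "t x \<star>\<^bsub>G\<^esub> t y = i (h x y) \<otimes>\<^bsub>G\<^esub> t (x \<star>\<^bsub>K\<^esub> y)"
proof -
  let ?g = "(t x \<star>\<^bsub>G\<^esub> t y) \<otimes>\<^bsub>G\<^esub> inv\<^bsub>G\<^esub> t (x \<star>\<^bsub>K\<^esub> y)"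
  have "?g \<in> carrier G" "\<beta> ?g = \<one>\<^bsub>K\<^esub>"
    using assms by simp_all
  then show "h x y \<in> carrier H" "t x \<star>\<^bsub>G\<^esub> t y = i (h x y) \<otimes>\<^bsub>G\<^esub> t (x \<star>\<^bsub>K\<^esub> y)"
    using assms by (simp_all add: assoc_h_def kernel_pullback G.m_assoc)
qed

lemma \<Gamma>_eq_action: "\<Gamma> x a = action (t x) a"
  by (simp add: assoc_\<Gamma>_def action_def)

lemma \<Gamma>_star:
  assumes "x \<in> carrier K" "a \<in> carrier H"
  shows \<Gamma>_closed: "\<Gamma> x a \<in> carrier H"
    and t_star_i: "t x \<star>\<^bsub>G\<^esub> i a = i (\<Gamma> x a)"
  using assms by (simp_all add: \<Gamma>_eq_action action_closed i_action)

definition coord :: "'g \<Rightarrow> 'h"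
  where "coord g = pullback H i (g \<otimes>\<^bsub>G\<^esub> inv\<^bsub>G\<^esub> t (\<beta> g))"

lemma coord:
  assumes "g \<in> carrier G"
  shows coord_closed: "coord g \<in> carrier H"
    and coord_decomp: "i (coord g) \<otimes>\<^bsub>G\<^esub> t (\<beta> g) = g"
proof -
  let ?g = "g \<otimes>\<^bsub>G\<^esub> inv\<^bsub>G\<^esub> t (\<beta> g)"
  have "?g \<in> carrier G" "\<beta> ?g = \<one>\<^bsub>K\<^esub>"
    using assms by simp_all
  then show "coord g \<in> carrier H" "i (coord g) \<otimes>\<^bsub>G\<^esub> t (\<beta> g) = g"
    using assms by (simp_all add: coord_def kernel_pullback G.m_assoc)
qed

lemma coord_it:
  "\<lbrakk>a \<in> carrier H; x \<in> carrier K\<rbrakk> \<Longrightarrow> coord (i a \<otimes>\<^bsub>G\<^esub> t x) = a"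
  by (simp add: coord_def G.m_assoc)

lemma mult_coordinates:
  assumes "a \<in> carrier H" "b \<in> carrier H" "x \<in> carrier K" "y \<in> carrier K"
  shows "(i a \<otimes>\<^bsub>G\<^esub> t x) \<otimes>\<^bsub>G\<^esub> (i b \<otimes>\<^bsub>G\<^esub> t y)
    = i (a \<otimes>\<^bsub>H\<^esub> b \<otimes>\<^bsub>H\<^esub> f x y) \<otimes>\<^bsub>G\<^esub> t (x \<otimes>\<^bsub>K\<^esub> y)"
  using assms by (subst mult_central_factors) (simp_all add: t_mult f_closed i_mult G.m_assoc)

lemma star_coordinates:
  assumes "a \<in> carrier H" "b \<in> carrier H" "x \<in> carrier K" "y \<in> carrier K"
  shows "(i a \<otimes>\<^bsub>G\<^esub> t x) \<star>\<^bsub>G\<^esub> (i b \<otimes>\<^bsub>G\<^esub> t y)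
    = i (\<Gamma> x b \<otimes>\<^bsub>H\<^esub> inv\<^bsub>H\<^esub> \<Gamma> y a \<otimes>\<^bsub>H\<^esub> h x y) \<otimes>\<^bsub>G\<^esub> t (x \<star>\<^bsub>K\<^esub> y)"
  using assms
  by (simp add: star_central_factors t_star h_closed i_mult G.m_assoc \<Gamma>_eq_action action_closed)

end

section \<open>Families over an automorphism of the quotient\<close>

locale automorphism_pair =
  center_extension_with_transversal H i G \<beta> K t
  for H :: "('h, 'l) mult_lie_scheme"
    and i :: "'h \<Rightarrow> 'g"
    and G :: "('g, 'm) mult_lie_scheme"
    and \<beta> :: "'g \<Rightarrow> 'k"
    and K :: "('k, 'n) mult_lie_scheme"
    and t :: "'k \<Rightarrow> 'g" +
  fixes \<alpha> :: "'h \<Rightarrow> 'h"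
    and \<eta> :: "'k \<Rightarrow> 'k"
  assumes \<alpha>_auto: "\<alpha> \<in> mla_auto H"
    and \<eta>_auto: "\<eta> \<in> mla_auto K"
begin

lemmas \<alpha>_closed [simp, intro] = mla_homD(1)[OF mla_autoD(1)[OF \<alpha>_auto]]
  and \<alpha>_mult = mla_homD(2)[OF mla_autoD(1)[OF \<alpha>_auto]]
  and \<alpha>_bij = mla_autoD(3)[OF \<alpha>_auto]
  and \<eta>_closed [simp, intro] = mla_homD(1)[OF mla_autoD(1)[OF \<eta>_auto]]
  and \<eta>_mult [simp] = mla_homD(2)[OF mla_autoD(1)[OF \<eta>_auto]]
  and \<eta>_star [simp] = mla_homD(3)[OF mla_autoD(1)[OF \<eta>_auto]]
  and \<eta>_bij = mla_autoD(3)[OF \<eta>_auto]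

lemma group_hom_\<alpha>: "group_hom H H \<alpha>"
  using mla_autoD(1)[OF \<alpha>_auto] by (simp add: group_hom_def group_hom_axioms_def mla_hom_def)

lemmas \<alpha>_one [simp] = group_hom.hom_one[OF group_hom_\<alpha>]
  and \<alpha>_inv = group_hom.hom_inv[OF group_hom_\<alpha>]

text \<open>The structure equations of \<open>t\<close>, read for \<open>T\<close> in place of \<open>t\<close> and with coefficients
  transported by \<open>\<alpha>\<close>.\<close>

definition transported_equations :: "('k \<Rightarrow> 'g) \<Rightarrow> bool"
  where "transported_equations T \<longleftrightarrow>
    (\<forall>x\<in>carrier K. \<forall>y\<in>carrier K. \<forall>a\<in>carrier H.
      T x \<otimes>\<^bsub>G\<^esub> T y = i (\<alpha> (f x y)) \<otimes>\<^bsub>G\<^esub> T (x \<otimes>\<^bsub>K\<^esub> y) \<and>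
      T x \<star>\<^bsub>G\<^esub> T y = i (\<alpha> (h x y)) \<otimes>\<^bsub>G\<^esub> T (x \<star>\<^bsub>K\<^esub> y) \<and>
      T x \<star>\<^bsub>G\<^esub> i (\<alpha> a) = i (\<alpha> (\<Gamma> x a)))"

definition family_over :: "('k \<Rightarrow> 'g) \<Rightarrow> bool"
  where "family_over T \<longleftrightarrow>
    (\<forall>x\<in>carrier K. T x \<in> carrier G \<and> \<beta> (T x) = \<eta> x)"

definition extension_map :: "('k \<Rightarrow> 'g) \<Rightarrow> 'g \<Rightarrow> 'g"
  where "extension_map T = (\<lambda>g\<in>carrier G. i (\<alpha> (coord g)) \<otimes>\<^bsub>G\<^esub> T (\<beta> g))"

lemma extension_map_it:
  "\<lbrakk>a \<in> carrier H; x \<in> carrier K\<rbrakk>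
    \<Longrightarrow> extension_map T (i a \<otimes>\<^bsub>G\<^esub> t x) = i (\<alpha> a) \<otimes>\<^bsub>G\<^esub> T x"
  by (simp add: extension_map_def coord_it)

text \<open>A family is not required to be normalised; the equation at \<open>x = y = \<one>\<close> forces it. This makes the
  map built from \<open>T\<close> restrict to \<open>\<alpha>\<close> on \<open>H\<close>.\<close>

lemma family_at_one:
  assumes "family_over T" "transported_equations T"
  shows "T \<one>\<^bsub>K\<^esub> = \<one>\<^bsub>G\<^esub>"
proof -
  have "f \<one>\<^bsub>K\<^esub> \<one>\<^bsub>K\<^esub> = \<one>\<^bsub>H\<^esub>"
    using pullback_i[of "\<one>\<^bsub>H\<^esub>"] by (simp add: assoc_f_def)
  moreover have "T \<one>\<^bsub>K\<^esub> \<otimes>\<^bsub>G\<^esub> T \<one>\<^bsub>K\<^esub> = i (\<alpha> (f \<one>\<^bsub>K\<^esub> \<one>\<^bsub>K\<^esub>)) \<otimes>\<^bsub>G\<^esub> T (\<one>\<^bsub>K\<^esub> \<otimes>\<^bsub>K\<^esub> \<one>\<^bsub>K\<^esub>)"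
    using assms(2) H.one_closed K.one_closed unfolding transported_equations_def by blast
  moreover have "T \<one>\<^bsub>K\<^esub> \<in> carrier G"
    using assms(1) by (simp add: family_over_def)
  ultimately show ?thesis
    by simp
qed

lemma extension_map_hom:
  assumes T: "family_over T" and eqs: "transported_equations T"
  shows "extension_map T \<in> mla_hom G G"
proof -
  have T_closed: "T x \<in> carrier G" if "x \<in> carrier K" for x
    using T that by (simp add: family_over_def)
  have T_mult: "T x \<otimes>\<^bsub>G\<^esub> T y = i (\<alpha> (f x y)) \<otimes>\<^bsub>G\<^esub> T (x \<otimes>\<^bsub>K\<^esub> y)"
    and T_star: "T x \<star>\<^bsub>G\<^esub> T y = i (\<alpha> (h x y)) \<otimes>\<^bsub>G\<^esub> T (x \<star>\<^bsub>K\<^esub> y)"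
    if "x \<in> carrier K" "y \<in> carrier K" for x y
    using eqs that H.one_closed unfolding transported_equations_def by blast+
  have T_action: "action (T x) (\<alpha> a) = \<alpha> (\<Gamma> x a)" if "x \<in> carrier K" "a \<in> carrier H" for x a
    using eqs that by (simp add: transported_equations_def action_def \<Gamma>_closed)
  let ?\<phi> = "extension_map T"
  have closed: "?\<phi> g \<in> carrier G" if "g \<in> carrier G" for g
    using that by (simp add: extension_map_def coord_closed T_closed)
  have pres: "?\<phi> (g \<otimes>\<^bsub>G\<^esub> g') = ?\<phi> g \<otimes>\<^bsub>G\<^esub> ?\<phi> g' \<and> ?\<phi> (g \<star>\<^bsub>G\<^esub> g') = ?\<phi> g \<star>\<^bsub>G\<^esub> ?\<phi> g'"
    if gg': "g \<in> carrier G" "g' \<in> carrier G" for g g'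
  proof -
    define a b x y where "a = coord g" and "b = coord g'" and "x = \<beta> g" and "y = \<beta> g'"
    have cl: "a \<in> carrier H" "b \<in> carrier H" "x \<in> carrier K" "y \<in> carrier K"
      using gg' by (simp_all add: a_def b_def x_def y_def coord_closed)
    note cls = cl f_closed h_closed \<Gamma>_closed T_closed
    have g: "g = i a \<otimes>\<^bsub>G\<^esub> t x" "g' = i b \<otimes>\<^bsub>G\<^esub> t y"
      using gg' by (simp_all add: a_def b_def x_def y_def coord_decomp)
    have "?\<phi> (g \<otimes>\<^bsub>G\<^esub> g') = i (\<alpha> (a \<otimes>\<^bsub>H\<^esub> b \<otimes>\<^bsub>H\<^esub> f x y)) \<otimes>\<^bsub>G\<^esub> T (x \<otimes>\<^bsub>K\<^esub> y)"
      using cls by (simp add: g mult_coordinates extension_map_it)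
    also have "\<dots> = i (\<alpha> a \<otimes>\<^bsub>H\<^esub> \<alpha> b) \<otimes>\<^bsub>G\<^esub> (T x \<otimes>\<^bsub>G\<^esub> T y)"
      using cls by (simp add: T_mult \<alpha>_mult i_mult G.m_assoc)
    also have "\<dots> = ?\<phi> g \<otimes>\<^bsub>G\<^esub> ?\<phi> g'"
      using cls by (simp add: g extension_map_it mult_central_factors)
    finally have mult: "?\<phi> (g \<otimes>\<^bsub>G\<^esub> g') = ?\<phi> g \<otimes>\<^bsub>G\<^esub> ?\<phi> g'" .
    have "?\<phi> (g \<star>\<^bsub>G\<^esub> g')
        = i (\<alpha> (\<Gamma> x b \<otimes>\<^bsub>H\<^esub> inv\<^bsub>H\<^esub> \<Gamma> y a \<otimes>\<^bsub>H\<^esub> h x y)) \<otimes>\<^bsub>G\<^esub> T (x \<star>\<^bsub>K\<^esub> y)"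
      using cls by (simp add: g star_coordinates extension_map_it)
    also have "\<dots> = i (\<alpha> (\<Gamma> x b) \<otimes>\<^bsub>H\<^esub> inv\<^bsub>H\<^esub> \<alpha> (\<Gamma> y a)) \<otimes>\<^bsub>G\<^esub> (T x \<star>\<^bsub>G\<^esub> T y)"
      using cls by (simp add: T_star \<alpha>_mult \<alpha>_inv i_mult G.m_assoc)
    also have "\<dots> = ?\<phi> g \<star>\<^bsub>G\<^esub> ?\<phi> g'"
      using cls by (simp add: g extension_map_it star_central_factors T_action)
    finally show ?thesis
      using mult by simp
  qed
  from closed pres show ?thesis
    by (auto simp: mla_hom_def hom_def)
qed

text \<open>The map covers the bijection \<open>\<eta>\<close> of \<open>K\<close> and acts as the bijection \<open>\<alpha>\<close> on the fibres, which
  are cosets of \<open>H\<close>.\<close>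

lemma extension_map_bij:
  assumes T: "family_over T"
  shows "bij_betw (extension_map T) (carrier G) (carrier G)"
proof -
  have T_closed: "T x \<in> carrier G" and \<beta>_T: "\<beta> (T x) = \<eta> x" if "x \<in> carrier K" for x
    using T that by (simp_all add: family_over_def)
  let ?\<phi> = "extension_map T"
  have closed: "?\<phi> g \<in> carrier G" if "g \<in> carrier G" for g
    using that by (simp add: extension_map_def coord_closed T_closed)
  have \<beta>_\<phi>: "\<beta> (?\<phi> g) = \<eta> (\<beta> g)" if "g \<in> carrier G" for g
    using that by (simp add: extension_map_def coord_closed T_closed \<beta>_T)
  have "inj_on ?\<phi> (carrier G)"
  proof (rule inj_onI)
    fix g g' assume gg': "g \<in> carrier G" "g' \<in> carrier G" "?\<phi> g = ?\<phi> g'"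
    then have "\<eta> (\<beta> g) = \<eta> (\<beta> g')"
      using \<beta>_\<phi> by metis
    then have \<beta>_eq: "\<beta> g = \<beta> g'"
      using gg' \<eta>_bij by (auto simp: bij_betw_def dest: inj_onD)
    then have "\<alpha> (coord g) = \<alpha> (coord g')"
      using gg' by (simp add: extension_map_def coord_closed T_closed)
    then have "coord g = coord g'"
      using gg' \<alpha>_bij coord_closed by (auto simp: bij_betw_def dest: inj_onD)
    then show "g = g'"
      using gg' \<beta>_eq coord_decomp by metis
  qed
  moreover have "g \<in> ?\<phi> ` carrier G" if g: "g \<in> carrier G" for g
  proof -
    obtain x where x: "x \<in> carrier K" "\<eta> x = \<beta> g"
      using g \<eta>_bij \<beta>_closed by (metis bij_betw_imp_surj_on imageE)
    let ?u = "g \<otimes>\<^bsub>G\<^esub> inv\<^bsub>G\<^esub> T x"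
    have u: "?u \<in> carrier G" "\<beta> ?u = \<one>\<^bsub>K\<^esub>"
      using g x by (simp_all add: T_closed \<beta>_T)
    obtain a where a: "a \<in> carrier H" "\<alpha> a = pullback H i ?u"
      using \<alpha>_bij kernel_pullback(1)[OF u] by (metis bij_betw_imp_surj_on imageE)
    have "?\<phi> (i a \<otimes>\<^bsub>G\<^esub> t x) = ?u \<otimes>\<^bsub>G\<^esub> T x"
      using a x by (simp add: extension_map_it kernel_pullback(2)[OF u])
    also have "\<dots> = g"
      using g x by (simp add: G.m_assoc T_closed)
    finally have "g = ?\<phi> (i a \<otimes>\<^bsub>G\<^esub> t x)" by simp
    with a x show ?thesis by (auto intro!: image_eqI)
  qed
  ultimately show ?thesis
    using closed by (auto simp: bij_betw_def)
qed

lemma inducible_if_family: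
  assumes T: "family_over T" and eqs: "transported_equations T"
  shows "inducible H i G \<beta> K t (\<alpha>, \<eta>)"
proof -
  let ?\<phi> = "extension_map T"
  have on_H: "?\<phi> (i a) = i (\<alpha> a)" if "a \<in> carrier H" for a
    using that extension_map_it[of a "\<one>\<^bsub>K\<^esub>" T] by (simp add: family_at_one[OF T eqs])
  have on_t: "?\<phi> (t x) = T x" if "x \<in> carrier K" for x
    using that T extension_map_it[of "\<one>\<^bsub>H\<^esub>" x T] by (simp add: family_over_def)
  have "?\<phi> \<in> mla_auto G"
    using extension_map_hom[OF T eqs] extension_map_bij[OF T]
    by (auto simp: mla_auto_def auto_def Bij_def mla_hom_def extension_map_def)
  moreover have "?\<phi> ` i ` carrier H = i ` \<alpha> ` carrier H"
    using on_H by (force simp: image_image)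
  then have "?\<phi> ` i ` carrier H = i ` carrier H"
    using \<alpha>_bij by (simp add: bij_betw_def)
  moreover have "induced_pair H i \<beta> K t ?\<phi> = (\<alpha>, \<eta>)"
  proof -
    have "(\<lambda>a\<in>carrier H. pullback H i (?\<phi> (i a))) = \<alpha>"
      using mla_autoD(2)[OF \<alpha>_auto] on_H by (auto simp: fun_eq_iff extensional_def)
    moreover have "(\<lambda>x\<in>carrier K. \<beta> (?\<phi> (t x))) = \<eta>"
      using mla_autoD(2)[OF \<eta>_auto] T on_t
      by (auto simp: fun_eq_iff extensional_def family_over_def)
    ultimately show ?thesis
      by (simp add: induced_pair_def)
  qed
  ultimately show ?thesis
    unfolding inducible_def Aut_sub_def by (metis (mono_tags, lifting) mem_Collect_eq)
qed

lemma family_if_inducible: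
  assumes "inducible H i G \<beta> K t (\<alpha>, \<eta>)"
  obtains T where "family_over T" "transported_equations T"
proof -
  obtain \<phi> where \<phi>: "\<phi> \<in> mla_auto G" "\<phi> ` i ` carrier H = i ` carrier H"
    and \<alpha>_eq: "\<alpha> = (\<lambda>a\<in>carrier H. pullback H i (\<phi> (i a)))"
    and \<eta>_eq: "\<eta> = (\<lambda>x\<in>carrier K. \<beta> (\<phi> (t x)))"
    using assms by (auto simp: inducible_def Aut_sub_def induced_pair_def)
  note \<phi>_hom = mla_homD[OF mla_autoD(1)[OF \<phi>(1)]]
  have on_H: "i (\<alpha> a) = \<phi> (i a)" if "a \<in> carrier H" for a
  proof -
    have "\<phi> (i a) \<in> i ` carrier H"
      using \<phi>(2) that by blast
    then show ?thesis
      using that by (auto simp: \<alpha>_eq)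
  qed
  have over: "\<beta> (\<phi> (t x)) = \<eta> x" if "x \<in> carrier K" for x
    using that \<eta>_eq by (metis restrict_apply')
  show ?thesis
  proof (rule that)
    show "family_over (\<lambda>x. \<phi> (t x))"
      by (simp add: family_over_def over \<phi>_hom(1))
    show "transported_equations (\<lambda>x. \<phi> (t x))"
      unfolding transported_equations_def
      by (intro ballI conjI)
        (simp_all add: on_H f_closed h_closed \<Gamma>_closed \<phi>_hom(2,3)[symmetric] t_mult t_star t_star_i)
  qed
qed

lemma inducible_iff_family:
  "inducible H i G \<beta> K t (\<alpha>, \<eta>) \<longleftrightarrow> (\<exists>T. family_over T \<and> transported_equations T)"
  using inducible_if_family family_if_inducible by metis

section \<open>Families as maps into the kernel\<close>

lemma family_over_iff:
  "family_over T \<longleftrightarrow>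
    (\<exists>l\<in>carrier K \<rightarrow> carrier H. \<forall>x\<in>carrier K. T x = i (l x) \<otimes>\<^bsub>G\<^esub> t (\<eta> x))"
proof
  assume T: "family_over T"
  show "\<exists>l\<in>carrier K \<rightarrow> carrier H. \<forall>x\<in>carrier K. T x = i (l x) \<otimes>\<^bsub>G\<^esub> t (\<eta> x)"
  proof (intro bexI ballI)
    show "(\<lambda>x. coord (T x)) \<in> carrier K \<rightarrow> carrier H"
      using T by (auto simp: family_over_def coord_closed)
    show "T x = i (coord (T x)) \<otimes>\<^bsub>G\<^esub> t (\<eta> x)" if "x \<in> carrier K" for x
      using T that coord_decomp[of "T x"] by (simp add: family_over_def)
  qed
next
  assume "\<exists>l\<in>carrier K \<rightarrow> carrier H. \<forall>x\<in>carrier K. T x = i (l x) \<otimes>\<^bsub>G\<^esub> t (\<eta> x)"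
  then show "family_over T"
    by (fastforce simp: family_over_def Pi_iff)
qed

lemma transported_equations_cong:
  assumes "\<And>x. x \<in> carrier K \<Longrightarrow> T x = T' x"
  shows "transported_equations T \<longleftrightarrow> transported_equations T'"
  using assms by (simp add: transported_equations_def cong: ball_cong)

text \<open>The multiplication and star equations for \<open>T(x) = \<lambda>(x) t(\<eta>(x))\<close> both have the shape on the
  left once \<open>H\<close>-factors are collected: \<open>p\<close> and \<open>q\<close> come from \<open>\<lambda>(x)\<close> and \<open>\<lambda>(y)\<close> in one order or the
  other, \<open>c\<close> is a value of \<open>f\<close> or \<open>h\<close> at \<open>(\<eta>(x), \<eta>(y))\<close>, \<open>d\<close> is the \<open>\<alpha>\<close>-image of its value
  at \<open>(x, y)\<close>, and \<open>e\<close> is the value of \<open>\<lambda>\<close> at \<open>xy\<close> or \<open>x \<star> y\<close>.\<close>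

lemma cancel_rearrange:
  assumes "p \<in> carrier H" "q \<in> carrier H" "c \<in> carrier H" "d \<in> carrier H" "e \<in> carrier H"
    and "g \<in> carrier G"
  shows "i (p \<otimes>\<^bsub>H\<^esub> q \<otimes>\<^bsub>H\<^esub> c) \<otimes>\<^bsub>G\<^esub> g = i d \<otimes>\<^bsub>G\<^esub> (i e \<otimes>\<^bsub>G\<^esub> g)
    \<longleftrightarrow> c \<otimes>\<^bsub>H\<^esub> inv\<^bsub>H\<^esub> d = e \<otimes>\<^bsub>H\<^esub> inv\<^bsub>H\<^esub> p \<otimes>\<^bsub>H\<^esub> inv\<^bsub>H\<^esub> q"
proof -
  interpret HC: comm_group H by (rule comm_group_H)
  have "i d \<otimes>\<^bsub>G\<^esub> (i e \<otimes>\<^bsub>G\<^esub> g) = i (d \<otimes>\<^bsub>H\<^esub> e) \<otimes>\<^bsub>G\<^esub> g"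
    using assms by (simp add: i_mult G.m_assoc)
  then have "i (p \<otimes>\<^bsub>H\<^esub> q \<otimes>\<^bsub>H\<^esub> c) \<otimes>\<^bsub>G\<^esub> g = i d \<otimes>\<^bsub>G\<^esub> (i e \<otimes>\<^bsub>G\<^esub> g)
      \<longleftrightarrow> (p \<otimes>\<^bsub>H\<^esub> q) \<otimes>\<^bsub>H\<^esub> c = d \<otimes>\<^bsub>H\<^esub> e"
    using assms by simp
  also have "\<dots> \<longleftrightarrow> c = inv\<^bsub>H\<^esub> (p \<otimes>\<^bsub>H\<^esub> q) \<otimes>\<^bsub>H\<^esub> (d \<otimes>\<^bsub>H\<^esub> e)"
    using assms by (metis H.inv_solve_left H.m_closed)
  also have "\<dots> \<longleftrightarrow> c = (e \<otimes>\<^bsub>H\<^esub> inv\<^bsub>H\<^esub> p \<otimes>\<^bsub>H\<^esub> inv\<^bsub>H\<^esub> q) \<otimes>\<^bsub>H\<^esub> d"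
    using assms by (simp add: HC.inv_mult HC.m_ac)
  also have "\<dots> \<longleftrightarrow> c \<otimes>\<^bsub>H\<^esub> inv\<^bsub>H\<^esub> d = e \<otimes>\<^bsub>H\<^esub> inv\<^bsub>H\<^esub> p \<otimes>\<^bsub>H\<^esub> inv\<^bsub>H\<^esub> q"
    using assms by (metis H.inv_solve_right' H.inv_closed H.m_closed)
  finally show ?thesis .
qed

text \<open>Substituting \<open>\<alpha>(a)\<close> for \<open>a\<close> removes the inverse of \<open>\<alpha>\<close>.\<close>

lemma Gamma_intertwined_iff:
  assumes x: "x \<in> carrier K"
  shows "(\<forall>a\<in>carrier H. \<Gamma> (\<eta> x) a = \<alpha> (\<Gamma> x (inv_into (carrier H) \<alpha> a)))
    \<longleftrightarrow> (\<forall>a\<in>carrier H. t (\<eta> x) \<star>\<^bsub>G\<^esub> i (\<alpha> a) = i (\<alpha> (\<Gamma> x a)))" (is "?L \<longleftrightarrow> ?R")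
proof -
  have "?L \<longleftrightarrow> (\<forall>a\<in>\<alpha> ` carrier H. \<Gamma> (\<eta> x) a = \<alpha> (\<Gamma> x (inv_into (carrier H) \<alpha> a)))"
    by (simp add: bij_betw_imp_surj_on[OF \<alpha>_bij])
  also have "\<dots> \<longleftrightarrow> (\<forall>a\<in>carrier H. \<Gamma> (\<eta> x) (\<alpha> a) = \<alpha> (\<Gamma> x a))"
    by (simp add: bij_betw_imp_inj_on[OF \<alpha>_bij])
  also have "\<dots> \<longleftrightarrow> ?R"
    using x by (simp add: t_star_i \<Gamma>_closed)
  finally show ?thesis .
qed

text \<open>In the star equation \<open>\<Gamma>\<^bsub>\<eta>(y)\<^esub>(\<lambda>(x))\<close> enters inverted, by antisymmetry, and cancelling inverts both
  terms once more: hence the inverse on \<open>\<lambda>(y)\<close> but not on \<open>\<lambda>(x)\<close>.\<close>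

lemma transported_equations_iff:
  assumes l: "l \<in> carrier K \<rightarrow> carrier H"
  shows "transported_equations (\<lambda>x. i (l x) \<otimes>\<^bsub>G\<^esub> t (\<eta> x)) \<longleftrightarrow>
    (\<forall>x\<in>carrier K. \<forall>y\<in>carrier K. \<forall>a\<in>carrier H.
      f (\<eta> x) (\<eta> y) \<otimes>\<^bsub>H\<^esub> inv\<^bsub>H\<^esub> \<alpha> (f x y)
        = l (x \<otimes>\<^bsub>K\<^esub> y) \<otimes>\<^bsub>H\<^esub> inv\<^bsub>H\<^esub> l x \<otimes>\<^bsub>H\<^esub> inv\<^bsub>H\<^esub> l y \<and>
      h (\<eta> x) (\<eta> y) \<otimes>\<^bsub>H\<^esub> inv\<^bsub>H\<^esub> \<alpha> (h x y)
        = l (x \<star>\<^bsub>K\<^esub> y) \<otimes>\<^bsub>H\<^esub> \<Gamma> (\<eta> y) (l x) \<otimes>\<^bsub>H\<^esub> \<Gamma> (\<eta> x) (inv\<^bsub>H\<^esub> l y) \<and>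
      \<Gamma> (\<eta> x) a = \<alpha> (\<Gamma> x (inv_into (carrier H) \<alpha> a)))"
proof -
  interpret HC: comm_group H by (rule comm_group_H)
  let ?T = "\<lambda>x. i (l x) \<otimes>\<^bsub>G\<^esub> t (\<eta> x)"
  have l_closed: "l x \<in> carrier H" if "x \<in> carrier K" for x
    using l that by auto
  note cls = l_closed f_closed h_closed \<Gamma>_closed
  have mult: "?T x \<otimes>\<^bsub>G\<^esub> ?T y = i (\<alpha> (f x y)) \<otimes>\<^bsub>G\<^esub> ?T (x \<otimes>\<^bsub>K\<^esub> y) \<longleftrightarrow>
      f (\<eta> x) (\<eta> y) \<otimes>\<^bsub>H\<^esub> inv\<^bsub>H\<^esub> \<alpha> (f x y)
        = l (x \<otimes>\<^bsub>K\<^esub> y) \<otimes>\<^bsub>H\<^esub> inv\<^bsub>H\<^esub> l x \<otimes>\<^bsub>H\<^esub> inv\<^bsub>H\<^esub> l y"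
    if xy: "x \<in> carrier K" "y \<in> carrier K" for x y
    using xy by (simp add: cls mult_coordinates cancel_rearrange)
  have star: "?T x \<star>\<^bsub>G\<^esub> ?T y = i (\<alpha> (h x y)) \<otimes>\<^bsub>G\<^esub> ?T (x \<star>\<^bsub>K\<^esub> y) \<longleftrightarrow>
      h (\<eta> x) (\<eta> y) \<otimes>\<^bsub>H\<^esub> inv\<^bsub>H\<^esub> \<alpha> (h x y)
        = l (x \<star>\<^bsub>K\<^esub> y) \<otimes>\<^bsub>H\<^esub> \<Gamma> (\<eta> y) (l x) \<otimes>\<^bsub>H\<^esub> \<Gamma> (\<eta> x) (inv\<^bsub>H\<^esub> l y)"
    if xy: "x \<in> carrier K" "y \<in> carrier K" for x y
  proof -
    have "\<Gamma> (\<eta> x) (inv\<^bsub>H\<^esub> l y) = inv\<^bsub>H\<^esub> \<Gamma> (\<eta> x) (l y)"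
      using xy by (simp add: \<Gamma>_eq_action action_inv l_closed)
    moreover have "l (x \<star>\<^bsub>K\<^esub> y) \<otimes>\<^bsub>H\<^esub> inv\<^bsub>H\<^esub> \<Gamma> (\<eta> x) (l y) \<otimes>\<^bsub>H\<^esub> \<Gamma> (\<eta> y) (l x)
        = l (x \<star>\<^bsub>K\<^esub> y) \<otimes>\<^bsub>H\<^esub> \<Gamma> (\<eta> y) (l x) \<otimes>\<^bsub>H\<^esub> inv\<^bsub>H\<^esub> \<Gamma> (\<eta> x) (l y)"
      using xy by (simp add: cls HC.m_ac)
    ultimately show ?thesis
      using xy by (simp add: cls star_coordinates cancel_rearrange)
  qed
  \<comment> \<open>The factor \<open>l x\<close> has trivial \<open>\<star>\<close>-product with \<open>H\<close>, so it drops out of the third equation.\<close>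
  have "?T x \<star>\<^bsub>G\<^esub> i (\<alpha> a) = t (\<eta> x) \<star>\<^bsub>G\<^esub> i (\<alpha> a)" if "x \<in> carrier K" "a \<in> carrier H" for x a
    using that by (simp add: G.star_mult_left conjugate_i i_star_i l_closed)
  then have act: "(\<forall>a\<in>carrier H. ?T x \<star>\<^bsub>G\<^esub> i (\<alpha> a) = i (\<alpha> (\<Gamma> x a))) \<longleftrightarrow>
      (\<forall>a\<in>carrier H. \<Gamma> (\<eta> x) a = \<alpha> (\<Gamma> x (inv_into (carrier H) \<alpha> a)))"
    if "x \<in> carrier K" for x
    using that Gamma_intertwined_iff by simp
  have split: "(\<forall>x\<in>carrier K. \<forall>y\<in>carrier K. \<forall>a\<in>carrier H. P x y \<and> Q x y \<and> R x a) \<longleftrightarrow>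
      (\<forall>x\<in>carrier K. \<forall>y\<in>carrier K. P x y) \<and> (\<forall>x\<in>carrier K. \<forall>y\<in>carrier K. Q x y) \<and>
      (\<forall>x\<in>carrier K. \<forall>a\<in>carrier H. R x a)" for P Q R
    using H.one_closed K.one_closed by blast
  show ?thesis
    unfolding transported_equations_def split
    by (simp only: mult star act cong: ball_cong)
qed

lemma inducible_iff_kernel_map:
  "inducible H i G \<beta> K t (\<alpha>, \<eta>) \<longleftrightarrow>
    (\<exists>l \<in> carrier K \<rightarrow> carrier H. transported_equations (\<lambda>x. i (l x) \<otimes>\<^bsub>G\<^esub> t (\<eta> x)))"
proof
  assume "inducible H i G \<beta> K t (\<alpha>, \<eta>)"
  then obtain T where T: "family_over T" "transported_equations T"
    by (auto simp: inducible_iff_family)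
  then obtain l where l: "l \<in> carrier K \<rightarrow> carrier H"
    "\<And>x. x \<in> carrier K \<Longrightarrow> T x = i (l x) \<otimes>\<^bsub>G\<^esub> t (\<eta> x)"
    by (auto simp: family_over_iff)
  then show "\<exists>l \<in> carrier K \<rightarrow> carrier H. transported_equations (\<lambda>x. i (l x) \<otimes>\<^bsub>G\<^esub> t (\<eta> x))"
    using T(2) transported_equations_cong[of T, OF l(2)] by blast
next
  assume "\<exists>l \<in> carrier K \<rightarrow> carrier H. transported_equations (\<lambda>x. i (l x) \<otimes>\<^bsub>G\<^esub> t (\<eta> x))"
  then obtain l where l: "l \<in> carrier K \<rightarrow> carrier H"
    and eqs: "transported_equations (\<lambda>x. i (l x) \<otimes>\<^bsub>G\<^esub> t (\<eta> x))"
    by blast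
  have "family_over (\<lambda>x. i (l x) \<otimes>\<^bsub>G\<^esub> t (\<eta> x))"
    unfolding family_over_iff using l by blast
  with eqs show "inducible H i G \<beta> K t (\<alpha>, \<eta>)"
    by (rule inducible_if_family[rotated])
qed

end

section \<open>The criterion for inducible pairs\<close>


theorem lemma2p2:
  fixes H :: "('h, 'l) mult_lie_scheme"
    and i :: "'h \<Rightarrow> 'g"
    and G :: "('g, 'm) mult_lie_scheme"
    and \<beta> :: "'g \<Rightarrow> 'k"
    and K :: "('k, 'n) mult_lie_scheme"
    and t :: "'k \<Rightarrow> 'g"
    and f h :: "'k \<Rightarrow> 'k \<Rightarrow> 'h"
    and \<Gamma> :: "'k \<Rightarrow> 'h \<Rightarrow> 'h"
    and \<alpha> :: "'h \<Rightarrow> 'h"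
    and \<eta> :: "'k \<Rightarrow> 'k"
  assumes ext: "center_extension H i G \<beta> K"
    and t: "transversal G \<beta> K t"
    and f: "f = assoc_f H i G K t"
    and h: "h = assoc_h H i G K t"
    and \<Gamma>: "\<Gamma> = assoc_\<Gamma> H i G t"
    and \<alpha>\<eta>: "(\<alpha>, \<eta>) \<in> mla_auto H \<times> mla_auto K"
  shows "(inducible H i G \<beta> K t (\<alpha>, \<eta>) \<longleftrightarrow>
          (\<exists>l \<in> carrier K \<rightarrow> carrier H.
            \<forall>x\<in>carrier K. \<forall>y\<in>carrier K. \<forall>a\<in>carrier H.
              f (\<eta> x) (\<eta> y) \<otimes>\<^bsub>H\<^esub> inv\<^bsub>H\<^esub> \<alpha> (f x y)
                = l (x \<otimes>\<^bsub>K\<^esub> y) \<otimes>\<^bsub>H\<^esub> inv\<^bsub>H\<^esub> l x \<otimes>\<^bsub>H\<^esub> inv\<^bsub>H\<^esub> l y \<and>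
              h (\<eta> x) (\<eta> y) \<otimes>\<^bsub>H\<^esub> inv\<^bsub>H\<^esub> \<alpha> (h x y)
                = l (x \<star>\<^bsub>K\<^esub> y) \<otimes>\<^bsub>H\<^esub> \<Gamma> (\<eta> y) (l x) \<otimes>\<^bsub>H\<^esub> \<Gamma> (\<eta> x) (inv\<^bsub>H\<^esub> l y) \<and>
              \<Gamma> (\<eta> x) a = \<alpha> (\<Gamma> x (inv_into (carrier H) \<alpha> a))))
       \<and> ((\<forall>x\<in>carrier K. \<forall>a\<in>carrier H.
              \<Gamma> (\<eta> x) a = \<alpha> (\<Gamma> x (inv_into (carrier H) \<alpha> a))) \<longleftrightarrow>
          (\<forall>x\<in>carrier K. \<forall>a\<in>carrier H.
              i (\<alpha> (pullback H i (t x \<star>\<^bsub>G\<^esub> i a))) = t (\<eta> x) \<star>\<^bsub>G\<^esub> i (\<alpha> a)))"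
proof -
  interpret center_extension H i G \<beta> K
    by (rule ext)
  interpret automorphism_pair H i G \<beta> K t \<alpha> \<eta>
    by unfold_locales (use t \<alpha>\<eta> in auto)
  have "(\<forall>a\<in>carrier H. \<Gamma> (\<eta> x) a = \<alpha> (\<Gamma> x (inv_into (carrier H) \<alpha> a))) \<longleftrightarrow>
      (\<forall>a\<in>carrier H. i (\<alpha> (pullback H i (t x \<star>\<^bsub>G\<^esub> i a))) = t (\<eta> x) \<star>\<^bsub>G\<^esub> i (\<alpha> a))"
    if "x \<in> carrier K" for x
    unfolding \<Gamma> Gamma_intertwined_iff[OF that] by (auto simp: assoc_\<Gamma>_def)
  then have "(\<forall>x\<in>carrier K. \<forall>a\<in>carrier H.
        \<Gamma> (\<eta> x) a = \<alpha> (\<Gamma> x (inv_into (carrier H) \<alpha> a))) \<longleftrightarrow>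
      (\<forall>x\<in>carrier K. \<forall>a\<in>carrier H.
        i (\<alpha> (pullback H i (t x \<star>\<^bsub>G\<^esub> i a))) = t (\<eta> x) \<star>\<^bsub>G\<^esub> i (\<alpha> a))"
    by (rule ball_cong[OF refl])
  moreover have "inducible H i G \<beta> K t (\<alpha>, \<eta>) \<longleftrightarrow>
      (\<exists>l \<in> carrier K \<rightarrow> carrier H.
        \<forall>x\<in>carrier K. \<forall>y\<in>carrier K. \<forall>a\<in>carrier H.
          f (\<eta> x) (\<eta> y) \<otimes>\<^bsub>H\<^esub> inv\<^bsub>H\<^esub> \<alpha> (f x y)
            = l (x \<otimes>\<^bsub>K\<^esub> y) \<otimes>\<^bsub>H\<^esub> inv\<^bsub>H\<^esub> l x \<otimes>\<^bsub>H\<^esub> inv\<^bsub>H\<^esub> l y \<and>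
          h (\<eta> x) (\<eta> y) \<otimes>\<^bsub>H\<^esub> inv\<^bsub>H\<^esub> \<alpha> (h x y)
            = l (x \<star>\<^bsub>K\<^esub> y) \<otimes>\<^bsub>H\<^esub> \<Gamma> (\<eta> y) (l x) \<otimes>\<^bsub>H\<^esub> \<Gamma> (\<eta> x) (inv\<^bsub>H\<^esub> l y) \<and>
          \<Gamma> (\<eta> x) a = \<alpha> (\<Gamma> x (inv_into (carrier H) \<alpha> a)))"
    unfolding f h \<Gamma> inducible_iff_kernel_map by (intro bex_cong refl transported_equations_iff)
  ultimately show ?thesis
    by blast
qed

end
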